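(* Let $Y_0=\{y_k\}_{k\ge 0}$. 1. The generating series $\mathrm{H}^-(N)=\sum_{w\in Y_0^*}\mathrm{H}^-_w(N)\,w$ is group-like (for the coproduct $\Delta_{*}$ dual to the quasi-shuffle product $*$ on $\mathbb{Q}\langle Y_0\rangle$) and $\log \mathrm{H}^-$ is primitive (for $\Delta_*$). Moreover, limits being taken coefficientwise, $$\lim_{N\to+\infty} g^{\odot -1}(N)\odot \mathrm{H}^-(N)=\lim_{z\to 1^-}h^{\odot -1}\big((1-z)^{-1}\big)\odot \mathrm{L}^-(z)=C^-,$$ where $C^-=\sum_{w\in Y_0^*}C^-_w\,w$. 2. The kernel $\ker \mathrm{H}^-_\bullet$ of the linear map $\mathrm{H}^-_\bullet : w\mapsto \mathrm{H}^-_w$ (from $\mathbb{Q}\langle Y_0\rangle$ to functions of $N$) is a prime ideal of $(\mathbb{Q}\langle Y_0\rangle,* )$, i.e. $\mathbb{Q}\langle Y_0\rangle\setminus\ker \mathrm{H}^-_\bullet$ is closed under $*$.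
   Context: $Y_0=\{y_k\}_{k\ge0}$ is an infinite alphabet, $Y_0^*$ the free monoid on it with neutral element $1_{Y_0^*}$ (the empty word). For $w=y_{s_1}\cdots y_{s_r}\in Y_0^*$, the length is $|w|=r$ and the weight is $(w)=s_1+\cdots+s_r$ (both $0$ for the empty word). For $w=y_{s_1}\cdots y_{s_r}$, $N\in\mathbb{N}$ and $|z|<1$: $$\mathrm{H}^-_w(N)=\sum_{N\ge n_1>\cdots>n_r>0}n_1^{s_1}\cdots n_r^{s_r},\qquad \mathrm{Li}^-_w(z)=\sum_{n_1>\cdots>n_r>0}n_1^{s_1}\cdots n_r^{s_r}z^{n_1},$$ with $\mathrm{H}^-_{1_{Y_0^*}}=1$, $\mathrm{Li}^-_{1_{Y_0^*}}=1$. Both are extended linearly to polynomials in $\mathbb{Q}\langle Y_0\rangle$. The generating series are $\mathrm{L}^-(z)=\sum_{w\in Y_0^*}\mathrm{Li}^-_w(z)\,w$ and $\mathrm{H}^-(N)=\sum_{w\in Y_0^*}\mathrm{H}^-_w(N)\,w$. The quasi-shuffle product $*$ on $\mathbb{Q}\langle Y_0\rangle$ is bilinear with $w*1=1*w=w$ and $y_iu*y_jv=y_i(u*y_jv)+y_j(y_iu*v)+y_{i+j}(u*v)$ for $i,j\ge0$, $u,v\in Y_0^*$. Its dual coproduct is $\langle\Delta_{*}S\mid u\otimes v\rangle=\langle S\mid u* v\rangle$ for $u,v\in Y_0^*$. A series $S$ with constant term $1$ is group-like if $\Delta_*S=S\otimes S$; $S$ is primitive if $\Delta_*S=S\otimes1+1\otimes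 S$. The logarithm is taken with respect to concatenation. $\odot$ is the Hadamard (coefficientwise) product of series over $Y_0$, and for a series $S$ with all coefficients nonzero $S^{\odot-1}$ is the series whose coefficients are the inverses of those of $S$. Also $$g(t)=\sum_{w\in Y_0^*}t^{(w)+|w|}w,\qquad h(t)=\sum_{w\in Y_0^*}((w)+|w|)!\,t^{(w)+|w|}w,\qquad C^-_w=\prod_{w=uv,\ v\ne 1_{Y_0^*}}\frac1{(v)+|v|}\in\mathbb{Q},$$ where the product runs over all factorizations $w=uv$ with $v$ nonempty (so $C^-_{1_{Y_0^*}}=1$). *)

theory Defs
  imports
    "HOL-Analysis.Infinite_Sum"
    "HOL-Library.Poly_Mapping"
    "HOL-Library.Groups_Big_Fun"
    "HOL-Algebra.Ideal"
begin

text \<open>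
  The word \<open>y\<^sub>s\<^sub>1 \<dots> y\<^sub>s\<^sub>r\<close> is the list \<open>[s\<^sub>1, \<dots>, s\<^sub>r]\<close>. Noncommutative polynomials are finitely
  supported functions on words, noncommutative series are arbitrary functions on words.
\<close>

type_synonym word = "nat list"
type_synonym npoly = "word \<Rightarrow>\<^sub>0 rat"
type_synonym 'a series = "word \<Rightarrow> 'a"

abbreviation weight :: "word \<Rightarrow> nat" where
  "weight w \<equiv> sum_list w"


definition dec_tuples :: "nat \<Rightarrow> nat list set" where
  "dec_tuples r = {ns. length ns = r \<and> sorted_wrt (>) ns \<and> (\<forall>n\<in>set ns. n > 0)}"

definition monom_at :: "word \<Rightarrow> nat list \<Rightarrow> nat" where
  "monom_at w ns = (\<Prod>i<length w. (ns ! i) ^ (w ! i))"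

text \<open>For the empty word the sum ranges over the empty tuple only and has value \<open>1\<close>.\<close>

definition H_minus :: "nat \<Rightarrow> rat series" where
  "H_minus N w = (\<Sum>ns | ns \<in> dec_tuples (length w) \<and> (\<forall>n\<in>set ns. n \<le> N). of_nat (monom_at w ns))"

definition Li_minus :: "complex \<Rightarrow> complex series" where
  "Li_minus z w =
     (if w = [] then 1
      else (\<Sum>\<^sub>\<infinity>ns\<in>dec_tuples (length w). of_nat (monom_at w ns) * z ^ hd ns))"


definition prepend :: "nat \<Rightarrow> npoly \<Rightarrow> npoly" where
  "prepend i P = (\<Sum>w\<in>Poly_Mapping.keys P. Poly_Mapping.single (i # w) (Poly_Mapping.lookup P w))"

fun qsh_word :: "word \<Rightarrow> word \<Rightarrow> npoly" where
  "qsh_word [] v = Poly_Mapping.single v 1"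
| "qsh_word (i # u) [] = Poly_Mapping.single (i # u) 1"
| "qsh_word (i # u) (j # v) =
     prepend i (qsh_word u (j # v)) + prepend j (qsh_word (i # u) v) + prepend (i + j) (qsh_word u v)"

definition qsh :: "npoly \<Rightarrow> npoly \<Rightarrow> npoly" where
  "qsh P Q =
     (\<Sum>u\<in>Poly_Mapping.keys P. \<Sum>v\<in>Poly_Mapping.keys Q.
        Poly_Mapping.map (\<lambda>c. Poly_Mapping.lookup P u * Poly_Mapping.lookup Q v * c) (qsh_word u v))"

definition qsh_ring :: "npoly ring" where
  "qsh_ring = \<lparr>carrier = UNIV, mult = qsh, one = Poly_Mapping.single [] 1, zero = 0, add = (+)\<rparr>"


definition pairing :: "rat series \<Rightarrow> npoly \<Rightarrow> rat" where
  "pairing S P = (\<Sum>w\<in>Poly_Mapping.keys P. S w * Poly_Mapping.lookup P w)"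

definition one_series :: "'a::comm_ring_1 series" where
  "one_series w = (if w = [] then 1 else 0)"

text \<open>A series over pairs of words stands for an element of the completed tensor square.\<close>

definition tensor :: "rat series \<Rightarrow> rat series \<Rightarrow> word \<Rightarrow> word \<Rightarrow> rat" where
  "tensor S T u v = S u * T v"

definition coproduct :: "rat series \<Rightarrow> word \<Rightarrow> word \<Rightarrow> rat" where
  "coproduct S u v = pairing S (qsh_word u v)"

definition group_like :: "rat series \<Rightarrow> bool" where
  "group_like S \<longleftrightarrow> S [] = 1 \<and> coproduct S = tensor S S"

definition primitive :: "rat series \<Rightarrow> bool" where
  "primitive S \<longleftrightarrow> coproduct S = (\<lambda>u v. tensor S one_series u v + tensor one_series S u v)"

definition conc :: "'a::comm_ring_1 series \<Rightarrow> 'a series \<Rightarrow> 'a series" where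
  "conc S T w = (\<Sum>(u, v) | u @ v = w. S u * T v)"

definition conc_power :: "'a::comm_ring_1 series \<Rightarrow> nat \<Rightarrow> 'a series" where
  "conc_power S n = (conc S ^^ n) one_series"

text \<open>
  \<open>log S = (\<Sum>n\<ge>1. (-1)\<^sup>n\<^sup>-\<^sup>1 / n \<cdot> (S - 1)\<^sup>n)\<close> for \<open>S\<close> with constant term \<open>1\<close>. In each coefficient only
  finitely many summands are nonzero, since \<open>(S - 1)\<^sup>n\<close> vanishes on words of length less than \<open>n\<close>;
  hence \<^const>\<open>Sum_any\<close> is the sum of the series.
\<close>

definition log_series :: "rat series \<Rightarrow> rat series" where
  "log_series S w =
     Sum_any (\<lambda>n. if n = 0 then 0
                  else (-1) ^ (n - 1) / of_nat n * conc_power (\<lambda>v. S v - one_series v) n w)"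

definition hadamard :: "'a::field series \<Rightarrow> 'a series \<Rightarrow> 'a series" where
  "hadamard S T w = S w * T w"

definition hadamard_inv :: "'a::field series \<Rightarrow> 'a series" where
  "hadamard_inv S w = inverse (S w)"

definition g_series :: "'a::field_char_0 \<Rightarrow> 'a series" where
  "g_series t w = t ^ (weight w + length w)"

definition h_series :: "'a::field_char_0 \<Rightarrow> 'a series" where
  "h_series t w = fact (weight w + length w) * t ^ (weight w + length w)"

definition C_minus :: "rat series" where
  "C_minus w = (\<Prod>(u, v) | u @ v = w \<and> v \<noteq> []. 1 / of_nat (weight v + length v))"


definition H_poly :: "npoly \<Rightarrow> nat \<Rightarrow> rat" where
  "H_poly P N = pairing (H_minus N) P"

definition ker_H :: "npoly set" where
  "ker_H = {P. H_poly P = (\<lambda>N. 0)}"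

end

theory Submission
  imports Defs "HOL-Computational_Algebra.Polynomial"
begin

text \<open>
  The series of \<open>H\<^sup>-(N)\<close> is the concatenation product over \<open>m = N, \<dots>, 1\<close> of the series
  \<open>1 + \<Sum>\<^sub>s m\<^sup>s y\<^sub>s\<close>. Any such product, over an arbitrary list of numbers, is group-like, by induction
  on the list; the powers of \<open>H\<^sup>-(N)\<close> are again of this form, which makes the logarithm primitive.
  These products separate noncommutative polynomials (in the first factor, compare the coefficients of
  the powers of \<open>m\<close>), so the ring axioms for the quasi-shuffle product are inherited from \<open>\<rat>\<close>.

  As a function of \<open>N\<close>, each \<open>H\<^sup>-\<^sub>w(N)\<close> is a polynomial of degree \<open>(w) + |w|\<close> with leading coefficient
  \<open>C\<^sup>-\<^sub>w\<close>, because it arises by iterated indefinite summation. This gives the first limit, and primality of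
  the kernel since polynomials over \<open>\<rat>\<close> form a domain. Finally \<open>Li\<^sup>-\<^sub>w(z)\<close> is a power series with polynomial
  coefficients, and \<open>(1 - x) \<Sum> p(n) x\<^sup>n = p(0) + x \<Sum> (p(n + 1) - p(n)) x\<^sup>n\<close> reduces its behaviour at \<open>1\<close>
  to lower degree.
\<close>

section \<open>Concatenation powers and the logarithm\<close>

text \<open>Factorizations of a word correspond to cut positions, which turns sums over pairs
  \<open>(u, v)\<close> into sums over a finite interval.\<close>

lemma sum_splits:
  "(\<Sum>(u, v) | u @ v = w. f u v) = (\<Sum>k\<le>length w. f (take k w) (drop k w))"
proof -
  have eq: "{(u, v). u @ v = w} = (\<lambda>k. (take k w, drop k w)) ` {..length w}"
  proof (intro subset_antisym subsetI)
    fix p assume "p \<in> {(u, v). u @ v = w}"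
    then show "p \<in> (\<lambda>k. (take k w, drop k w)) ` {..length w}"
      by (auto intro!: rev_image_eqI[of "length (fst p)"])
  qed auto
  have "inj_on (\<lambda>k. (take k w, drop k w)) {..length w}"
    by (rule inj_onI) (metis Pair_inject atMost_iff length_take min.absorb2)
  then show ?thesis
    unfolding eq by (simp add: sum.reindex)
qed

lemma conc_Nil: "conc S T [] = S [] * T []"
  by (simp add: conc_def sum_splits)

lemma conc_Cons: "conc S T (i # w) = S [] * T (i # w) + conc (\<lambda>v. S (i # v)) T w"
  by (simp add: conc_def sum_splits sum.atMost_Suc_shift del: sum.atMost_Suc)

lemma conc_add_left: "conc (\<lambda>v. S v + S' v) T w = conc S T w + conc S' T w"
  by (simp add: conc_def sum_splits sum.distrib algebra_simps)

lemma conc_mult_left: "conc (\<lambda>v. c * S v) T w = c * conc S T w"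
  by (simp add: conc_def sum_splits sum_distrib_left algebra_simps)

lemma conc_sum_right: "conc S (\<lambda>v. \<Sum>k\<in>A. c k * T k v) w = (\<Sum>k\<in>A. c k * conc S (T k) w)"
proof -
  have "conc S (\<lambda>v. \<Sum>k\<in>A. c k * T k v) w
      = (\<Sum>l\<le>length w. \<Sum>k\<in>A. c k * (S (take l w) * T k (drop l w)))"
    by (simp add: conc_def sum_splits sum_distrib_left algebra_simps)
  also have "\<dots> = (\<Sum>k\<in>A. c k * conc S (T k) w)"
    by (subst sum.swap) (simp add: conc_def sum_splits sum_distrib_left)
  finally show ?thesis .
qed

lemma conc_one_left: "conc one_series T w = T w"
proof (cases w)
  case Nil
  then show ?thesis by (simp add: conc_Nil one_series_def)
next
  case (Cons i w')
  have "conc (\<lambda>v. one_series (i # v)) T w' = 0"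
    by (simp add: conc_def sum_splits one_series_def)
  then show ?thesis by (simp add: Cons conc_Cons one_series_def)
qed

lemma conc_power_0 [simp]: "conc_power S 0 = one_series"
  and conc_power_Suc [simp]: "conc_power S (Suc n) = conc S (conc_power S n)"
  by (simp_all add: conc_power_def)

lemma conc_power_eq_0:
  assumes "S [] = 0" "length w < n"
  shows "conc_power S n w = 0"
  using assms(2)
proof (induction n arbitrary: w)
  case (Suc n)
  have "S (take k w) * conc_power S n (drop k w) = 0" if "k \<le> length w" for k
    using assms(1) Suc.prems that by (cases k) (simp_all add: Suc.IH)
  then show ?case by (auto simp: conc_def sum_splits)
qed simp

text \<open>Binomial theorem for \<open>S = 1 + X\<close>. Since \<open>X\<close> has no constant
  term, the upper limit \<open>length w\<close> does not depend on \<open>t\<close>, so each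
  coefficient of a power is a polynomial in the exponent.\<close>

lemma conc_power_binomial:
  fixes S :: "'a::comm_ring_1 series"
  assumes "S [] = 1"
  defines "X \<equiv> \<lambda>v. S v - one_series v"
  shows "conc_power S t w = (\<Sum>k\<le>length w. of_nat (t choose k) * conc_power X k w)"
proof -
  have X0: "X [] = 0"
    using assms by (simp add: one_series_def)
  have step: "conc S T v = T v + conc X T v" for T v
  proof -
    have "S = (\<lambda>v. one_series v + X v)" by (auto simp: X_def)
    then have "conc S T v = conc (\<lambda>v. one_series v + X v) T v" by simp
    then show ?thesis by (simp add: conc_add_left conc_one_left)
  qed
  \<comment> \<open>The limit \<open>K\<close> stays free in the induction: Pascal's rule combines
    the hypothesis at \<open>K\<close> with the one at its predecessor \<open>K'\<close>.\<close>
  have *: "conc_power S t v = (\<Sum>k\<le>K. of_nat (t choose k) * conc_power X k v)"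
    if "t \<le> K" for K v
    using that
  proof (induction t arbitrary: v K)
    case 0
    then show ?case
      by (induction K) auto
  next
    case (Suc t)
    then obtain K' where K: "K = Suc K'" "t \<le> K'" by (cases K) auto
    have "conc_power S (Suc t) v = conc_power S t v + conc X (conc_power S t) v"
      by (simp add: step)
    also have "conc_power S t v = (\<Sum>k\<le>K. of_nat (t choose k) * conc_power X k v)"
      using Suc by simp
    also have "conc_power S t = (\<lambda>v. \<Sum>k\<le>K'. of_nat (t choose k) * conc_power X k v)"
      using Suc.IH K by blast
    also have "conc X \<dots> v = (\<Sum>k\<le>K'. of_nat (t choose k) * conc_power X (Suc k) v)"
      by (simp add: conc_sum_right)
    finally show ?case
      unfolding K
      by (simp add: sum.atMost_Suc_shift sum.distrib algebra_simps del: sum.atMost_Suc)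
  qed
  have "conc_power S t w = (\<Sum>k\<le>t + length w. of_nat (t choose k) * conc_power X k w)"
    by (rule *) simp
  also have "\<dots> = (\<Sum>k\<le>length w. of_nat (t choose k) * conc_power X k w)"
    by (rule sum.mono_neutral_right) (auto simp: conc_power_eq_0[where S = X, OF X0])
  finally show ?thesis .
qed

lemma log_series_eq:
  assumes "S [] = 1"
  shows "log_series S w =
    (\<Sum>k\<in>{1..length w}. (-1) ^ (k - 1) / of_nat k * conc_power (\<lambda>v. S v - one_series v) k w)"
proof -
  let ?X = "\<lambda>v. S v - one_series v"
  have X0: "?X [] = 0"
    using assms by (simp add: one_series_def)
  have "log_series S w = (\<Sum>k\<in>{1..length w}. if k = 0 then 0
      else (-1) ^ (k - 1) / of_nat k * conc_power ?X k w)"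
    unfolding log_series_def
  proof (rule Sum_any.expand_superset)
    have "k \<le> length w" if "conc_power ?X k w \<noteq> 0" for k
      using that conc_power_eq_0[where S = ?X, OF X0, of w k] by (meson leI)
    then show "{k. (if k = 0 then 0
        else (-1) ^ (k - 1) / of_nat k * conc_power ?X k w) \<noteq> 0} \<subseteq> {1..length w}"
      by (auto split: if_splits)
  qed simp
  then show ?thesis
    by (auto intro!: sum.cong)
qed

section \<open>Binomial coefficients as polynomials in the upper argument\<close>

fun binomial_poly :: "nat \<Rightarrow> 'a::field_char_0 poly" where
  "binomial_poly 0 = 1"
| "binomial_poly (Suc k) = smult (1 / of_nat (Suc k)) (binomial_poly k * [:- of_nat k, 1:])"

lemma poly_binomial_poly: "poly (binomial_poly k) (of_nat t) = of_nat (t choose k)"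
proof (induction k)
  case (Suc k)
  have "of_nat (Suc k) * of_nat (t choose Suc k) = (of_nat (t choose k) * (of_nat t - of_nat k) :: 'a)"
  proof (cases "k \<le> t")
    case True
    have "Suc k * (t choose Suc k) = (t choose k) * (t - k)"
      by (metis binomial_absorb_comp binomial_absorption mult.commute)
    then show ?thesis
      by (metis True of_nat_diff of_nat_mult)
  qed (simp add: binomial_eq_0)
  then show ?case
    by (simp add: Suc field_simps del: of_nat_Suc)
qed simp

lemma coeff_0_binomial_poly: "coeff (binomial_poly k) 0 = (if k = 0 then 1 else 0)"
proof (induction k)
  case (Suc k)
  then show ?case by (cases k) (auto simp: coeff_mult)
qed simp

text \<open>These are the coefficients of \<open>log (1 + x)\<close>, which is how the logarithm
  arises as the part of \<open>(1 + x)^t\<close> linear in \<open>t\<close>.\<close>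

lemma coeff_1_binomial_poly:
  "coeff (binomial_poly k) 1 = (if k = 0 then 0 else (-1) ^ (k - 1) / of_nat k)"
proof (induction k)
  case (Suc k)
  have "coeff (binomial_poly k * [:- of_nat k, 1:]) 1
      = coeff (binomial_poly k) 0 - of_nat k * (coeff (binomial_poly k) 1 :: 'a)"
    by (simp add: coeff_mult)
  also have "\<dots> = (-1) ^ k"
    using Suc by (cases k) (simp_all add: coeff_0_binomial_poly del: of_nat_Suc)
  finally show ?case
    by (simp del: mult_pCons_right of_nat_Suc)
qed simp

lemma poly_eqI_of_nat:
  fixes p q :: "'a::field_char_0 poly"
  assumes "\<And>n::nat. poly p (of_nat n) = poly q (of_nat n)"
  shows "p = q"
proof (rule ccontr)
  assume "p \<noteq> q"
  then have "finite {x. poly (p - q) x = 0}"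
    by (intro poly_roots_finite) simp
  moreover have "range of_nat \<subseteq> {x. poly (p - q) x = 0}"
    using assms by auto
  ultimately have "finite (range (of_nat :: nat \<Rightarrow> 'a))"
    by (rule finite_subset[rotated])
  then show False
    using finite_imageD[OF _ inj_of_nat] by auto
qed

text \<open>
  Extending \<open>t \<mapsto> S\<^sup>t\<close> to a polynomial in \<open>t\<close>, the logarithm of \<open>S\<close> is the linear coefficient.
  Primitivity is the linear coefficient of the group-like identity for \<open>S\<^sup>t\<close>.
\<close>

lemma primitive_log_series:
  assumes S: "S [] = 1" and gl: "\<And>t. group_like (conc_power S t)"
  shows "primitive (log_series S)"
proof -
  define X where "X = (\<lambda>v. S v - one_series v)"
  define P :: "word \<Rightarrow> rat poly" where
    "P w = (\<Sum>k\<le>length w. smult (conc_power X k w) (binomial_poly k))" for w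
  have P: "poly (P w) (of_nat t) = conc_power S t w" for w t
    by (simp add: P_def poly_sum poly_binomial_poly conc_power_binomial[where S = S, OF S] X_def mult.commute)
  \<comment> \<open>Evaluation at \<open>t = 0\<close>, where the power is the unit series.\<close>
  have P0: "coeff (P w) 0 = one_series w" for w
  proof -
    have "coeff (P w) 0 = poly (P w) (of_nat 0)" by (simp add: poly_0_coeff_0)
    then show ?thesis by (simp only: P) simp
  qed
  have P1: "coeff (P w) 1 = log_series S w" for w
  proof -
    have "coeff (P w) 1
        = (\<Sum>k\<le>length w. conc_power X k w * (if k = 0 then 0 else (-1) ^ (k - 1) / of_nat k))"
      unfolding P_def coeff_sum coeff_smult coeff_1_binomial_poly ..
    also have "\<dots> = log_series S w"
      unfolding log_series_eq[where S = S, OF S] X_def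
      by (rule sum.mono_neutral_cong_right) (auto simp: mult.commute)
    finally show ?thesis .
  qed
  have "coproduct (log_series S) u v
      = tensor (log_series S) one_series u v + tensor one_series (log_series S) u v" for u v
  proof -
    let ?K = "Poly_Mapping.keys (qsh_word u v)" and ?c = "Poly_Mapping.lookup (qsh_word u v)"
    have "(\<Sum>w\<in>?K. smult (?c w) (P w)) = P u * P v"
    proof (rule poly_eqI_of_nat)
      fix t
      have "pairing (conc_power S t) (qsh_word u v) = conc_power S t u * conc_power S t v"
        using gl[of t] by (simp add: group_like_def coproduct_def tensor_def fun_eq_iff)
      then show "poly (\<Sum>w\<in>?K. smult (?c w) (P w)) (of_nat t) = poly (P u * P v) (of_nat t)"
        by (simp add: poly_sum P pairing_def mult.commute)
    qed
    \<comment> \<open>As the constant coefficients form \<open>one_series\<close>, the linear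
      coefficient of \<open>P u * P v\<close> is the two-term expression that defines
      primitivity.\<close>
    then have "coeff (\<Sum>w\<in>?K. smult (?c w) (P w)) 1 = coeff (P u * P v) 1"
      by simp
    then show ?thesis
      by (simp only: coproduct_def pairing_def tensor_def coeff_sum coeff_smult P1 coeff_mult)
         (simp add: P0 P1[unfolded One_nat_def] mult.commute)
  qed
  then show ?thesis
    by (auto simp: primitive_def fun_eq_iff)
qed

section \<open>Group-like products and the quasi-shuffle ring\<close>

lemma pairing_zero [simp]: "pairing S 0 = 0"
  by (simp add: pairing_def)

lemma pairing_superset:
  assumes "finite A" "Poly_Mapping.keys P \<subseteq> A"
  shows "pairing S P = (\<Sum>w\<in>A. S w * Poly_Mapping.lookup P w)"
  unfolding pairing_def
  by (rule sum.mono_neutral_left) (use assms in \<open>auto simp: in_keys_iff\<close>)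

lemma pairing_add: "pairing S (P + Q) = pairing S P + pairing S Q"
proof -
  let ?A = "Poly_Mapping.keys P \<union> Poly_Mapping.keys Q"
  have "pairing S R = (\<Sum>w\<in>?A. S w * Poly_Mapping.lookup R w)" if "R \<in> {P, Q, P + Q}" for R
    using that keys_add[of P Q] by (intro pairing_superset) auto
  then show ?thesis
    by (simp add: lookup_add algebra_simps sum.distrib)
qed

lemma pairing_uminus: "pairing S (- P) = - pairing S P"
  using pairing_add[of S P "- P"] by (simp add: pairing_def)

lemma pairing_sum: "pairing S (\<Sum>x\<in>A. P x) = (\<Sum>x\<in>A. pairing S (P x))"
  by (induction A rule: infinite_finite_induct) (auto simp: pairing_add)

lemma pairing_single: "pairing S (Poly_Mapping.single w c) = S w * c"
  by (simp add: pairing_def)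

lemma pairing_map_mult:
  "pairing S (Poly_Mapping.map (\<lambda>x. c * x) P) = c * pairing S P"
proof -
  have lk: "Poly_Mapping.lookup (Poly_Mapping.map (\<lambda>x. c * x) P) w = c * Poly_Mapping.lookup P w" for w
    by (simp add: Poly_Mapping.map.rep_eq when_def)
  have "pairing S (Poly_Mapping.map (\<lambda>x. c * x) P)
      = (\<Sum>w\<in>Poly_Mapping.keys P. S w * (c * Poly_Mapping.lookup P w))"
    by (subst pairing_superset[OF finite_keys[of P]]) (auto simp: in_keys_iff lk)
  then show ?thesis
    by (simp add: pairing_def sum_distrib_left algebra_simps)
qed

text \<open>Prepending a letter is adjoint to stripping it from the series, so the recursion of
  \<open>qsh_word\<close> can be evaluated under a pairing.\<close>

lemma pairing_prepend: "pairing S (prepend i P) = pairing (\<lambda>w. S (i # w)) P"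
  by (simp add: prepend_def pairing_sum pairing_single) (simp add: pairing_def)

lemma pairing_qsh:
  assumes "\<And>u v. pairing S (qsh_word u v) = S u * S v"
  shows "pairing S (qsh P Q) = pairing S P * pairing S Q"
  by (simp add: qsh_def pairing_sum pairing_map_mult assms sum_product)
     (simp add: pairing_def sum_product algebra_simps)

lemma pairing_qsh_word_Nil:
  assumes "S [] = 1"
  shows "pairing S (qsh_word [] v) = S [] * S v" "pairing S (qsh_word u []) = S u * S []"
  using assms by (cases u; simp add: pairing_single)+

lemma group_likeI:
  assumes "S [] = 1"
    and "\<And>i u j v. pairing S (qsh_word (i # u) (j # v)) = S (i # u) * S (j # v)"
  shows "group_like S"
proof -
  have "pairing S (qsh_word u v) = S u * S v" for u v
    using assms pairing_qsh_word_Nil[where S = S, OF assms(1)] by (cases u; cases v) simp_all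
  then show ?thesis
    by (simp add: group_like_def coproduct_def tensor_def assms fun_eq_iff)
qed

lemma group_like_pairing: "group_like S \<Longrightarrow> pairing S (qsh_word u v) = S u * S v"
  by (simp add: group_like_def coproduct_def tensor_def fun_eq_iff)

text \<open>
  The concatenation product of the series \<open>1 + \<Sum>\<^sub>s m\<^sup>s y\<^sub>s\<close>, with \<open>m\<close> running through the given list.
\<close>

fun letter_product :: "nat list \<Rightarrow> rat series" where
  "letter_product [] w = one_series w"
| "letter_product (m # ms) [] = 1"
| "letter_product (m # ms) (i # w) = letter_product ms (i # w) + of_nat m ^ i * letter_product ms w"

lemma letter_product_Nil [simp]: "letter_product ms [] = 1"
  by (cases ms) (simp_all add: one_series_def)

text \<open>Write \<open>F\<close> for the product over \<open>ms\<close>. Expanding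
  \<open>(F (i # u) + m^i F u) (F (j # v) + m^j F v)\<close> gives
  \<open>F (i # u) F (j # v)\<close> and three terms with \<open>m^i\<close>, \<open>m^j\<close> and
  \<open>m^(i+j)\<close>, one for each summand of the quasi-shuffle recursion.\<close>

lemma group_like_letter_product: "group_like (letter_product ms)"
proof (induction ms)
  case Nil
  \<comment> \<open>A prepended polynomial has no constant term, and the empty product sees nothing
    else.\<close>
  have "pairing (letter_product []) (prepend i P) = 0" for i P
    by (simp add: pairing_prepend) (simp add: pairing_def one_series_def)
  then show ?case
    by (intro group_likeI) (simp_all add: pairing_add del: letter_product.simps(1),
        simp_all add: one_series_def)
next
  case (Cons m ms)
  let ?F = "letter_product ms"
  have prep: "pairing (letter_product (m # ms)) (prepend i P)
      = pairing ?F (prepend i P) + of_nat m ^ i * pairing ?F P" for i P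
    by (simp add: pairing_prepend)
       (simp add: pairing_def sum.distrib sum_distrib_left algebra_simps)
  have "pairing (letter_product (m # ms)) (qsh_word (i # u) (j # v))
      = pairing ?F (qsh_word (i # u) (j # v)) + of_nat m ^ i * pairing ?F (qsh_word u (j # v))
        + of_nat m ^ j * pairing ?F (qsh_word (i # u) v)
        + of_nat m ^ (i + j) * pairing ?F (qsh_word u v)" for i j u v
    by (simp add: pairing_add prep)
  then show ?case
    by (intro group_likeI)
       (simp_all add: group_like_pairing[OF Cons.IH] algebra_simps power_add del: qsh_word.simps)
qed

text \<open>Products of letter products are letter products, so all powers stay group-like, as
  \<open>primitive_log_series\<close> requires.\<close>

lemma conc_letter_product:
  "conc (letter_product ms) (letter_product ns) = letter_product (ms @ ns)"
proof (induction ms)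
  case Nil
  have "letter_product [] = one_series" by (rule ext) simp
  then show ?case by (simp add: conc_one_left fun_eq_iff)
next
  case (Cons m ms)
  show ?case
  proof
    fix w
    show "conc (letter_product (m # ms)) (letter_product ns) w = letter_product ((m # ms) @ ns) w"
    proof (cases w)
      case Nil
      then show ?thesis by (simp add: conc_Nil)
    next
      case w: (Cons i v)
      have "conc (letter_product (m # ms)) (letter_product ns) w
          = conc (letter_product ms) (letter_product ns) w
            + of_nat m ^ i * conc (letter_product ms) (letter_product ns) v"
        by (simp add: w conc_Cons conc_add_left conc_mult_left)
      then show ?thesis by (simp add: w Cons.IH)
    qed
  qed
qed

lemma group_like_conc_power_letter_product: "group_like (conc_power (letter_product ms) t)"
proof -
  have "\<exists>ns. conc_power (letter_product ms) t = letter_product ns"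
  proof (induction t)
    case 0
    have "letter_product [] = one_series" by (rule ext) simp
    then show ?case by (metis conc_power_0)
  next
    case (Suc t)
    then show ?case by (metis conc_letter_product conc_power_Suc)
  qed
  then show ?thesis by (metis group_like_letter_product)
qed

text \<open>Induction on the word: a first letter \<open>i\<close> is detected as the exponent of a
  newly added factor \<open>m\<close>.\<close>

lemma letter_product_separating:
  assumes "finite A" and "\<And>ms. (\<Sum>w\<in>A. letter_product ms w * c w) = 0" and "w \<in> A"
  shows "c w = 0"
  using assms
proof (induction w arbitrary: A c)
  case Nil
  have "(\<Sum>w\<in>A. letter_product [] w * c w) = (\<Sum>w\<in>A. if w = [] then c w else 0)"
    by (rule sum.cong) (auto simp: one_series_def)
  then show ?case using Nil by (simp del: letter_product.simps(1))
next
  case (Cons i w)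
  let ?B = "{v. i # v \<in> A}"
  have fin: "finite ?B"
    using finite_vimageI[OF \<open>finite A\<close>, of "(#) i"] by (simp add: vimage_def)
  have "(\<Sum>v\<in>?B. letter_product ms v * c (i # v)) = 0" for ms
  proof -
    \<comment> \<open>At a natural \<open>m\<close>, \<open>q\<close> is the difference of the
      vanishing sums for \<open>m # ms\<close> and \<open>ms\<close>; its coefficient of degree
      \<open>i\<close> keeps only the words that begin with \<open>i\<close>.\<close>
    define q :: "rat poly" where
      "q = (\<Sum>u\<in>A. case u of [] \<Rightarrow> 0 | j # v \<Rightarrow> monom (letter_product ms v * c u) j)"
    have "q = 0"
    proof (rule poly_eqI_of_nat)
      fix m
      have "poly q (of_nat m) = (\<Sum>u\<in>A. letter_product (m # ms) u * c u - letter_product ms u * c u)"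
        unfolding q_def poly_sum
        by (intro sum.cong refl) (auto simp: poly_monom algebra_simps split: list.splits)
      then show "poly q (of_nat m) = poly 0 (of_nat m)"
        using Cons.prems(2) by (simp add: sum_subtractf)
    qed
    have "(\<Sum>v\<in>?B. letter_product ms v * c (i # v))
        = (\<Sum>u\<in>(#) i ` ?B. letter_product ms (tl u) * c u)"
      by (simp add: sum.reindex)
    also have "\<dots> = (\<Sum>u\<in>A. case u of [] \<Rightarrow> 0 | j # v \<Rightarrow> coeff (monom (letter_product ms v * c u) j) i)"
      by (rule sum.mono_neutral_cong_left) (use Cons.prems(1) in \<open>auto split: list.splits\<close>)
    also have "\<dots> = coeff q i"
      unfolding q_def coeff_sum by (intro sum.cong refl) (auto split: list.splits)
    finally show ?thesis using \<open>q = 0\<close> by simp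
  qed
  then show ?case
    using Cons.IH[OF fin, of "\<lambda>v. c (i # v)"] Cons.prems(3) by simp
qed

lemma npoly_eqI:
  assumes "\<And>ms. pairing (letter_product ms) P = pairing (letter_product ms) Q"
  shows "P = Q"
proof -
  let ?R = "P + - Q"
  have "Poly_Mapping.lookup ?R w = 0" for w
  proof (cases "w \<in> Poly_Mapping.keys ?R")
    case True
    have "pairing (letter_product ms) ?R = 0" for ms
      using assms[of ms] by (simp only: pairing_add pairing_uminus right_minus)
    then show ?thesis
      using letter_product_separating[OF finite_keys[of ?R], of "Poly_Mapping.lookup ?R" w] True
      by (simp add: pairing_def)
  qed (simp add: in_keys_iff)
  then have "?R = 0" by (intro poly_mapping_eqI) simp
  then show ?thesis by simp
qed

text \<open>Pairing with a letter product is multiplicative and these pairings are jointly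
  injective, so the axioms involving products become identities of rational numbers.\<close>

lemma cring_qsh_ring: "cring qsh_ring"
proof (rule cringI)
  note pq = pairing_qsh[OF group_like_pairing[OF group_like_letter_product]]
  show "abelian_group qsh_ring"
    by (rule abelian_groupI) (auto simp: qsh_ring_def add_ac intro: exI[of _ "- _"])
  show "comm_monoid qsh_ring"
    by (rule comm_monoidI) (auto simp: qsh_ring_def pq pairing_single intro!: npoly_eqI)
  show "(x \<oplus>\<^bsub>qsh_ring\<^esub> y) \<otimes>\<^bsub>qsh_ring\<^esub> z
      = x \<otimes>\<^bsub>qsh_ring\<^esub> z \<oplus>\<^bsub>qsh_ring\<^esub> y \<otimes>\<^bsub>qsh_ring\<^esub> z" for x y z
    by (auto simp: qsh_ring_def pq pairing_add algebra_simps intro!: npoly_eqI)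
qed

section \<open>Harmonic sums as polynomials\<close>

definition bounded_tuples :: "nat \<Rightarrow> nat \<Rightarrow> nat list set" where
  "bounded_tuples r N = {ns \<in> dec_tuples r. \<forall>n\<in>set ns. n \<le> N}"

lemma finite_bounded_tuples [simp]: "finite (bounded_tuples r N)"
proof (rule finite_subset)
  show "bounded_tuples r N \<subseteq> {ns. set ns \<subseteq> {..N} \<and> length ns = r}"
    by (auto simp: bounded_tuples_def dec_tuples_def)
qed (rule finite_lists_length_eq, simp)

text \<open>The two cases are whether or not the largest entry equals \<open>Suc N\<close>.\<close>

lemma bounded_tuples_Suc:
  "bounded_tuples (Suc r) (Suc N) = bounded_tuples (Suc r) N \<union> (#) (Suc N) ` bounded_tuples r N"
proof (intro subset_antisym subsetI)
  fix ns assume "ns \<in> bounded_tuples (Suc r) (Suc N)"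
  then show "ns \<in> bounded_tuples (Suc r) N \<union> (#) (Suc N) ` bounded_tuples r N"
    by (cases ns) (auto simp: bounded_tuples_def dec_tuples_def image_iff le_Suc_eq
        less_Suc_eq_le dest: order.strict_trans2)
qed (auto simp: bounded_tuples_def dec_tuples_def less_Suc_eq_le le_SucI)

text \<open>Splits off the largest entry, written \<open>Suc n\<close> because entries are positive.
  The tail is bounded by \<open>n\<close>, so summing over it yields
  \<open>H_minus n\<close>.\<close>

lemma dec_tuples_Suc:
  "dec_tuples (Suc r) = (\<lambda>(n, ns). Suc n # ns) ` (SIGMA n:UNIV. bounded_tuples r n)"
proof (intro subset_antisym subsetI)
  fix ns assume "ns \<in> dec_tuples (Suc r)"
  then obtain m ms where "ns = Suc m # ms"
    by (auto simp: dec_tuples_def length_Suc_conv gr0_conv_Suc)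
  moreover from this \<open>ns \<in> dec_tuples (Suc r)\<close> have "ms \<in> bounded_tuples r m"
    by (auto simp: bounded_tuples_def dec_tuples_def)
  ultimately
  show "ns \<in> (\<lambda>(n, ns). Suc n # ns) ` (SIGMA n:UNIV. bounded_tuples r n)"
    by auto
qed (auto simp: bounded_tuples_def dec_tuples_def less_Suc_eq_le)

lemma monom_at_Cons: "monom_at (i # w) (n # ns) = n ^ i * monom_at w ns"
  by (simp add: monom_at_def prod.lessThan_Suc_shift del: prod.lessThan_Suc)

lemma H_minus_eq: "H_minus N w = (\<Sum>ns\<in>bounded_tuples (length w) N. of_nat (monom_at w ns))"
  by (simp add: H_minus_def bounded_tuples_def)

lemma H_minus_Nil: "H_minus N [] = 1"
proof -
  have "bounded_tuples 0 N = {[]}"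
    by (auto simp: bounded_tuples_def dec_tuples_def)
  then show ?thesis by (simp add: H_minus_eq monom_at_def)
qed

lemma H_minus_0_Cons: "H_minus 0 (i # w) = 0"
proof -
  have "bounded_tuples (Suc r) 0 = {}" for r
    by (auto simp: bounded_tuples_def dec_tuples_def length_Suc_conv)
  then show ?thesis by (simp add: H_minus_eq)
qed

lemma H_minus_Suc_Cons:
  "H_minus (Suc N) (i # w) = H_minus N (i # w) + of_nat (Suc N) ^ i * H_minus N w"
proof -
  have "bounded_tuples (Suc r) N \<inter> (#) (Suc N) ` bounded_tuples r N = {}" for r
    by (auto simp: bounded_tuples_def)
  then show ?thesis
    by (simp add: H_minus_eq bounded_tuples_Suc sum.union_disjoint sum.reindex monom_at_Cons
        sum_distrib_left del: of_nat_Suc)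
qed

text \<open>Tuples decrease, so the factor for the largest index stands first and the list is
  reversed.\<close>

lemma H_minus_eq_letter_product: "H_minus N = letter_product (rev [1..<Suc N])"
proof (induction N)
  case 0
  have "H_minus 0 w = one_series w" for w
    by (cases w) (simp_all add: H_minus_Nil H_minus_0_Cons one_series_def)
  then show ?case by (simp add: fun_eq_iff)
next
  case (Suc N)
  show ?case
  proof
    fix w
    show "H_minus (Suc N) w = letter_product (rev [1..<Suc (Suc N)]) w"
      using Suc by (cases w) (simp_all add: H_minus_Nil H_minus_Suc_Cons del: of_nat_Suc)
  qed
qed

lemma group_like_H_minus: "group_like (H_minus N)"
  by (simp add: H_minus_eq_letter_product group_like_letter_product)

lemma primitive_log_H_minus: "primitive (log_series (H_minus N))"
  unfolding H_minus_eq_letter_product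
  by (intro primitive_log_series group_like_conc_power_letter_product) simp

lemma C_minus_eq:
  "C_minus w = (\<Prod>k<length w. 1 / of_nat (weight (drop k w) + length (drop k w)))"
proof -
  have eq: "{(u, v). u @ v = w \<and> v \<noteq> []} = (\<lambda>k. (take k w, drop k w)) ` {..<length w}"
  proof (intro subset_antisym subsetI)
    fix p assume "p \<in> {(u, v). u @ v = w \<and> v \<noteq> []}"
    then show "p \<in> (\<lambda>k. (take k w, drop k w)) ` {..<length w}"
      by (auto intro!: rev_image_eqI[of "length (fst p)"])
  qed auto
  have "inj_on (\<lambda>k. (take k w, drop k w)) {..<length w}"
    by (rule inj_onI) (metis Pair_inject lessThan_iff length_take min.absorb4)
  then show ?thesis
    unfolding C_minus_def eq by (simp add: prod.reindex del: length_drop of_nat_add)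
qed

lemma C_minus_Nil: "C_minus [] = 1"
  by (simp add: C_minus_eq)

text \<open>The nonempty suffixes of \<open>i # w\<close> are those of \<open>w\<close> and the
  whole word, which supplies the new factor.\<close>

lemma C_minus_Cons: "C_minus (i # w) = C_minus w / of_nat (weight (i # w) + length (i # w))"
  unfolding C_minus_eq by (simp add: prod.lessThan_Suc_shift del: prod.lessThan_Suc)

section \<open>The forward difference operator and indefinite summation\<close>

definition forward_diff :: "'a::comm_ring_1 poly \<Rightarrow> 'a poly" where
  "forward_diff p = pcompose p [:1, 1:] - p"

lemma poly_forward_diff: "poly (forward_diff p) x = poly p (x + 1) - poly p x"
  by (simp add: forward_diff_def poly_pcompose add.commute)

lemma forward_diff_add: "forward_diff (p + q) = forward_diff p + forward_diff q"
  by (simp add: forward_diff_def pcompose_add)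

lemma forward_diff_pCons: "forward_diff (pCons a p) = pCons 0 (forward_diff p) + p + forward_diff p"
  by (simp add: forward_diff_def pcompose_pCons algebra_simps)

text \<open>For \<open>p = a + x q\<close>, with \<open>D\<close> the difference operator,
  \<open>D p = x D q + q + D q\<close>. In the step to \<open>Suc k\<close> the first two terms
  contribute \<open>k + 1\<close> copies and one copy of the top coefficient, the third none. A
  bound in place of the exact degree admits zero top coefficients.\<close>

lemma forward_diff_leading:
  "degree p \<le> Suc k \<Longrightarrow>
    degree (forward_diff p) \<le> k \<and> coeff (forward_diff p) k = of_nat (Suc k) * coeff p (Suc k)"
proof (induction k arbitrary: p)
  case 0
  obtain a q where p: "p = pCons a q" by (cases p)
  then have "degree q = 0" using 0 by (auto split: if_splits)
  then obtain b where "p = [:a, b:]" using p by (metis degree_eq_zeroE)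
  then show ?case by (simp add: forward_diff_pCons) (simp add: forward_diff_def)
next
  case (Suc k)
  obtain a q where p: "p = pCons a q" by (cases p)
  have q: "degree q \<le> Suc k" using Suc.prems by (auto simp: p split: if_splits)
  have IH: "degree (forward_diff q) \<le> k" "coeff (forward_diff q) k = of_nat (Suc k) * coeff q (Suc k)"
    using Suc.IH[OF q] by auto
  have "degree (pCons 0 (forward_diff q)) \<le> Suc k"
    using IH(1) by (meson degree_pCons_le le_trans Suc_le_mono)
  then show ?case
    using q IH by (auto simp: p forward_diff_pCons coeff_eq_0 algebra_simps intro!: degree_add_le)
qed

text \<open>Indefinite summation of polynomials, with \<open>a\<close> as the constant of
  summation.\<close>

lemma forward_diff_surj:
  fixes p :: "'a::field_char_0 poly"
  assumes "degree p \<le> k"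
  shows "\<exists>q. forward_diff q = p \<and> degree q \<le> Suc k \<and> poly q 0 = a"
  using assms
proof (induction k arbitrary: p a)
  case 0
  then obtain c where "p = [:c:]" by (metis degree_eq_zeroE le_zero_eq)
  then have "forward_diff [:a, c:] = p \<and> degree [:a, c:] \<le> Suc 0 \<and> poly [:a, c:] 0 = a"
    by (simp add: forward_diff_pCons) (simp add: forward_diff_def)
  then show ?case by blast
next
  case (Suc k)
  \<comment> \<open>The difference of this monomial has the same top coefficient as
    \<open>p\<close>, so subtracting it lowers the degree bound.\<close>
  define m :: "'a poly" where "m = monom (coeff p (Suc k) / of_nat (Suc (Suc k))) (Suc (Suc k))"
  have m: "degree m \<le> Suc (Suc k)" by (simp add: m_def degree_monom_le)
  have d: "degree (p - forward_diff m) \<le> Suc k"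
    using forward_diff_leading[OF m] Suc.prems by (intro degree_diff_le) auto
  have "coeff (p - forward_diff m) (Suc k) = 0"
    using forward_diff_leading[OF m] by (simp add: m_def del: of_nat_Suc)
  then have "degree (p - forward_diff m) \<le> k"
    using d by (metis degree_0 le_SucE leading_coeff_0_iff zero_le)
  from Suc.IH[OF this, of a] obtain q where
    q: "forward_diff q = p - forward_diff m" "degree q \<le> Suc k" "poly q 0 = a" by blast
  have "poly m 0 = 0" by (simp add: m_def poly_monom)
  then show ?case
    using q m by (intro exI[of _ "q + m"]) (auto simp: forward_diff_add intro!: degree_add_le)
qed

lemma coeff_linear_power_mult:
  fixes p :: "'a::idom poly"
  assumes "degree p \<le> d"
  shows "degree ([:a, 1:] ^ i * p) \<le> i + d \<and> coeff ([:a, 1:] ^ i * p) (i + d) = coeff p d"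
proof (induction i)
  case (Suc i)
  let ?p = "[:a, 1:] ^ i * p"
  have "degree (pCons 0 ?p) \<le> Suc (i + d)"
    using Suc by (meson degree_pCons_le le_trans Suc_le_mono)
  moreover have "degree (smult a ?p) \<le> Suc (i + d)"
    using Suc degree_smult_le[of a ?p] by linarith
  ultimately have "degree (smult a ?p + pCons 0 ?p) \<le> Suc (i + d)"
    by (rule degree_add_le[rotated])
  moreover have "[:a, 1:] ^ Suc i * p = smult a ?p + pCons 0 ?p"
    by (simp add: algebra_simps)
  moreover have "coeff ?p (Suc (i + d)) = 0"
    using Suc by (intro coeff_eq_0) simp
  ultimately show ?case
    using Suc by simp
qed (use assms in simp)

text \<open>As a function of \<open>N\<close>, the sum for \<open>i # w\<close> has difference
  \<open>(N + 1)^i\<close> times the sum for \<open>w\<close>. Summation raises the degree bound by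
  one and divides the top coefficient by the new bound, exactly as \<open>C_minus\<close> does. The
  field is general because both rational and real polynomials are needed later.\<close>

lemma H_minus_polynomial:
  "\<exists>q :: 'a::field_char_0 poly. degree q \<le> weight w + length w
    \<and> coeff q (weight w + length w) = of_rat (C_minus w)
    \<and> (\<forall>N. of_rat (H_minus N w) = poly q (of_nat N))"
proof (induction w)
  case Nil
  show ?case by (rule exI[of _ 1]) (simp add: H_minus_Nil C_minus_Nil)
next
  case (Cons i w)
  let ?d = "weight w + length w"
  from Cons obtain q :: "'a poly" where q: "degree q \<le> ?d" "coeff q ?d = of_rat (C_minus w)"
    "\<And>N. of_rat (H_minus N w) = poly q (of_nat N)" by blast
  let ?r = "[:1, 1:] ^ i * q"
  have r: "degree ?r \<le> i + ?d" "coeff ?r (i + ?d) = of_rat (C_minus w)"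
    using coeff_linear_power_mult[OF q(1), of 1 i] q(2) by simp_all
  \<comment> \<open>The initial value 0 matches the empty sum at \<open>N = 0\<close>.\<close>
  from forward_diff_surj[OF r(1), of 0] obtain Q where
    Q: "forward_diff Q = ?r" "degree Q \<le> Suc (i + ?d)" "poly Q 0 = 0" by blast
  have lead: "of_nat (Suc (i + ?d)) * coeff Q (Suc (i + ?d)) = of_rat (C_minus w)"
    using forward_diff_leading[OF Q(2)] Q(1) r(2) by simp
  have C: "coeff Q (Suc (i + ?d)) = of_rat (C_minus (i # w))"
  proof -
    have "of_rat (C_minus (i # w)) = (of_rat (C_minus w) :: 'a) / of_nat (Suc (i + ?d))"
      unfolding C_minus_Cons by (simp add: of_rat_divide del: of_nat_Suc of_nat_add)
    also have "\<dots> = coeff Q (Suc (i + ?d))"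
      unfolding lead[symmetric] by (simp del: of_nat_Suc of_nat_add)
    finally show ?thesis ..
  qed
  have "of_rat (H_minus N (i # w)) = poly Q (of_nat N)" for N
  proof (induction N)
    case 0
    then show ?case by (simp add: H_minus_0_Cons Q(3))
  next
    case (Suc N)
    have "poly Q (of_nat (Suc N)) = poly Q (of_nat N) + poly (forward_diff Q) (of_nat N)"
      by (simp add: poly_forward_diff add.commute)
    then show ?case
      by (simp add: Q(1) H_minus_Suc_Cons of_rat_add of_rat_mult of_rat_power Suc q(3) add.commute)
  qed
  then show ?case
    using Q(2) C by (intro exI[of _ Q]) (simp add: add.assoc)
qed

lemma poly_over_power_tendsto:
  fixes p :: "real poly"
  assumes "degree p \<le> d"
  shows "((\<lambda>N::nat. poly p (of_nat N) / of_nat N ^ d) \<longlongrightarrow> coeff p d) sequentially"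
proof -
  have "((\<lambda>N. \<Sum>k\<le>d. coeff p k * (of_nat N ^ k / of_nat N ^ d)) \<longlongrightarrow> (\<Sum>k\<le>d. coeff p k * (if k = d then 1 else 0)))
      sequentially"
  proof (intro tendsto_sum tendsto_mult tendsto_const)
    fix k assume "k \<in> {..d}"
    \<comment> \<open>With \<open>0 / 0 = 0\<close> the equality fails at \<open>N = 0\<close> when
      \<open>k = d > 0\<close>, so it is claimed only eventually.\<close>
    have "eventually (\<lambda>N. inverse (real N) ^ (d - k) = of_nat N ^ k / of_nat N ^ d) sequentially"
      using eventually_gt_at_top[of 0]
      by eventually_elim
         (use \<open>k \<in> {..d}\<close> in \<open>simp add: power_diff power_inverse field_simps\<close>)
    moreover have "((\<lambda>N. inverse (real N) ^ (d - k)) \<longlongrightarrow> (if k = d then 1 else 0)) sequentially"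
    proof (cases "k = d")
      case False
      then have "((\<lambda>N. inverse (real N) ^ (d - k)) \<longlongrightarrow> 0 ^ (d - k)) sequentially"
        by (intro tendsto_power lim_inverse_n)
      then show ?thesis
        using False \<open>k \<in> {..d}\<close> by (simp only: atMost_iff zero_power if_False)
    qed simp
    ultimately show "((\<lambda>N. real N ^ k / real N ^ d) \<longlongrightarrow> (if k = d then 1 else 0)) sequentially"
      by (rule Lim_transform_eventually[rotated])
  qed
  moreover have "poly p x / x ^ d = (\<Sum>k\<le>d. coeff p k * (x ^ k / x ^ d))" for x
    using arg_cong[OF poly_as_sum_of_monoms'[OF assms], of "\<lambda>p. poly p x"]
    by (simp add: poly_sum poly_monom sum_divide_distrib [symmetric])
  ultimately show ?thesis by (simp add: if_distrib sum.delta' cong: if_cong)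
qed

section \<open>Primality of the kernel\<close>

lemma ker_H_iff: "P \<in> ker_H \<longleftrightarrow> (\<forall>N. pairing (H_minus N) P = 0)"
  by (simp add: ker_H_def H_poly_def fun_eq_iff)

lemma pairing_H_minus_qsh: "pairing (H_minus N) (qsh P Q) = pairing (H_minus N) P * pairing (H_minus N) Q"
  by (rule pairing_qsh) (rule group_like_pairing[OF group_like_H_minus])

lemma pairing_H_minus_polynomial: "\<exists>q. \<forall>N. pairing (H_minus N) P = poly q (of_nat N)"
proof -
  have "\<forall>w. \<exists>q. \<forall>N. H_minus N w = poly q (of_nat N)"
    using H_minus_polynomial[where 'a = rat] by (simp add: of_rat_eq_id) blast
  then obtain q where "\<And>w N. H_minus N w = poly (q w) (of_nat N)" by metis
  then show ?thesis
    by (intro exI[of _ "\<Sum>w\<in>Poly_Mapping.keys P. smult (Poly_Mapping.lookup P w) (q w)"])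
       (simp add: pairing_def poly_sum mult.commute)
qed

text \<open>The two values are polynomials in \<open>N\<close> whose product vanishes at all
  naturals, hence is zero, and rational polynomials form a domain.\<close>

lemma qsh_in_ker_H_iff: "qsh P Q \<in> ker_H \<longleftrightarrow> P \<in> ker_H \<or> Q \<in> ker_H"
proof
  assume PQ: "qsh P Q \<in> ker_H"
  obtain p q where p: "\<And>N. pairing (H_minus N) P = poly p (of_nat N)"
    and q: "\<And>N. pairing (H_minus N) Q = poly q (of_nat N)"
    using pairing_H_minus_polynomial by metis
  have "p * q = 0"
    using PQ by (intro poly_eqI_of_nat) (simp add: ker_H_iff pairing_H_minus_qsh p q)
  then show "P \<in> ker_H \<or> Q \<in> ker_H"
    by (auto simp: ker_H_iff p q)
qed (auto simp: ker_H_iff pairing_H_minus_qsh)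

lemma primeideal_ker_H: "primeideal ker_H qsh_ring"
proof (rule primeidealI)
  interpret cring qsh_ring by (rule cring_qsh_ring)
  have neg: "\<ominus>\<^bsub>qsh_ring\<^esub> P = - P" for P
    by (rule minus_equality) (simp_all add: qsh_ring_def)
  show "ideal ker_H qsh_ring"
  proof (rule idealI)
    show "subgroup ker_H (add_monoid qsh_ring)"
    proof (rule add.subgroupI)
      have "0 \<in> ker_H" by (simp add: ker_H_iff)
      then show "ker_H \<noteq> {}" by blast
    qed (use neg in \<open>auto simp: a_inv_def ker_H_iff pairing_add pairing_uminus qsh_ring_def\<close>)
  qed (rule ring_axioms, simp_all add: qsh_ring_def qsh_in_ker_H_iff)
  have "Poly_Mapping.single [] 1 \<notin> ker_H"
    by (simp add: ker_H_iff pairing_single H_minus_Nil)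
  then show "carrier qsh_ring \<noteq> ker_H"
    by (auto simp: qsh_ring_def)
next
  show "cring qsh_ring" by (rule cring_qsh_ring)
  show "P \<in> ker_H \<or> Q \<in> ker_H" if "P \<otimes>\<^bsub>qsh_ring\<^esub> Q \<in> ker_H" for P Q
    using that by (simp add: qsh_ring_def qsh_in_ker_H_iff)
qed

section \<open>Asymptotics\<close>

lemma summable_poly_power:
  fixes p :: "real poly"
  assumes "\<bar>x\<bar> < 1"
  shows "summable (\<lambda>n. poly p (of_nat n) * x ^ n)"
proof -
  have mono: "summable (\<lambda>n. of_nat n ^ k * x ^ n)" if "\<bar>x\<bar> < 1" for k and x :: real
    using that
  proof (induction k arbitrary: x)
    case 0
    then show ?case by (simp add: summable_geometric)
  next
    case (Suc k)
    \<comment> \<open>Termwise differentiation produces the coefficients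
      \<open>(n + 1)^(k + 1)\<close>. It needs the hypothesis on the whole interval of convergence,
      hence the generalized \<open>x\<close>.\<close>
    have "summable (\<lambda>n. diffs (\<lambda>n. of_nat n ^ k) n * x ^ n)"
      by (rule termdiff_converges[of _ 1]) (use Suc in auto)
    then have "summable (\<lambda>n. of_nat (Suc n) ^ Suc k * x ^ n * x)"
      by (simp add: diffs_def summable_mult2 del: of_nat_Suc)
    then have "summable (\<lambda>n. of_nat (Suc n) ^ Suc k * x ^ Suc n)"
      by (simp add: mult_ac del: of_nat_Suc)
    then show ?case
      by (subst (asm) summable_Suc_iff)
  qed
  have "summable (\<lambda>n. \<Sum>k\<le>degree p. coeff p k * (of_nat n ^ k * x ^ n))"
    by (intro summable_sum summable_mult mono assms)
  then show ?thesis
    by (simp add: poly_altdef sum_distrib_right mult.assoc)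
qed

abbreviation poly_gen :: "real poly \<Rightarrow> real \<Rightarrow> real" where
  "poly_gen p x \<equiv> suminf (\<lambda>n. poly p (of_nat n) * x ^ n)"

text \<open>Summation by parts: a factor \<open>1 - x\<close> trades \<open>p\<close> for its
  difference, at the cost of the boundary term \<open>poly p 0\<close>.\<close>

lemma poly_power_series_diff:
  fixes p :: "real poly"
  assumes "\<bar>x\<bar> < 1"
  shows "(1 - x) * poly_gen p x
    = poly p 0 + x * poly_gen (forward_diff p) x"
proof -
  let ?f = "\<lambda>p n. poly p (of_nat n) * x ^ n"
  have s: "summable (?f p)" for p by (rule summable_poly_power[OF assms])
  have "x * suminf (?f (forward_diff p)) = suminf (\<lambda>n. x * ?f (forward_diff p) n)"
    by (rule suminf_mult[symmetric]) (rule s)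
  also have "\<dots> = suminf (\<lambda>n. ?f p (Suc n) - x * ?f p n)"
    by (simp add: poly_forward_diff algebra_simps)
  also have "\<dots> = suminf (\<lambda>n. ?f p (Suc n)) - suminf (\<lambda>n. x * ?f p n)"
    using s[of p] by (intro suminf_diff[symmetric] summable_mult) (subst summable_Suc_iff)
  also have "suminf (\<lambda>n. ?f p (Suc n)) = suminf (?f p) - poly p 0"
    using suminf_split_head[OF s] by simp
  also have "suminf (\<lambda>n. x * ?f p n) = x * suminf (?f p)"
    by (rule suminf_mult) (rule s)
  finally show ?thesis by (simp add: algebra_simps)
qed

text \<open>Each factor \<open>1 - x\<close> lowers the degree bound while the top coefficient is
  multiplied by the old bound, which builds up the factorial. The remaining powers of
  \<open>1 - x\<close> kill the boundary terms.\<close>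

lemma poly_power_series_tendsto:
  fixes p :: "real poly"
  assumes "degree p \<le> k"
  shows "((\<lambda>x. (1 - x) ^ Suc k * poly_gen p x) \<longlongrightarrow> fact k * coeff p k) (at_left 1)"
  using assms
proof (induction k arbitrary: p)
  case 0
  then obtain c where p: "p = [:c:]" by (metis degree_eq_zeroE le_zero_eq)
  have "eventually (\<lambda>x. c = (1 - x) ^ Suc 0 * poly_gen p x) (at_left 1)"
  proof (rule eventually_at_leftI[of 0])
    fix x :: real assume "x \<in> {0<..<1}"
    then have "(1 - x) * poly_gen p x = poly p 0"
      using poly_power_series_diff[of x p] by (simp add: p forward_diff_pCons)
         (simp add: forward_diff_def)
    then show "c = (1 - x) ^ Suc 0 * poly_gen p x"
      by (simp add: p)
  qed simp
  then show ?case
    by (rule Lim_transform_eventually[rotated]) (simp add: p)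
next
  case (Suc k)
  let ?d = "forward_diff p"
  have d: "degree ?d \<le> k" "coeff ?d k = of_nat (Suc k) * coeff p (Suc k)"
    using forward_diff_leading[OF Suc.prems] by auto
  have "((\<lambda>x. (1 - x) ^ Suc k * poly p 0 + x * ((1 - x) ^ Suc k * poly_gen ?d x))
      \<longlongrightarrow> (1 - 1) ^ Suc k * poly p 0 + 1 * (fact k * coeff ?d k)) (at_left 1)"
    by (intro tendsto_intros Suc.IH d(1))
  then have "((\<lambda>x. (1 - x) ^ Suc k * poly p 0 + x * ((1 - x) ^ Suc k * poly_gen ?d x))
      \<longlongrightarrow> fact (Suc k) * coeff p (Suc k)) (at_left 1)"
    by (simp add: d(2) algebra_simps)
  moreover have "eventually (\<lambda>x. (1 - x) ^ Suc k * poly p 0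
        + x * ((1 - x) ^ Suc k * poly_gen ?d x)
      = (1 - x) ^ Suc (Suc k) * poly_gen p x) (at_left 1)"
  proof (rule eventually_at_leftI[of 0])
    fix x :: real assume "x \<in> {0<..<1}"
    then have "(1 - x) ^ Suc k * ((1 - x) * poly_gen p x)
        = (1 - x) ^ Suc k * (poly p 0 + x * poly_gen ?d x)"
      using poly_power_series_diff[of x p] by simp
    then show "(1 - x) ^ Suc k * poly p 0 + x * ((1 - x) ^ Suc k * poly_gen ?d x)
      = (1 - x) ^ Suc (Suc k) * poly_gen p x"
      by (simp only: power_Suc2[of _ "Suc k"] mult.assoc) (simp only: distrib_left mult_ac)
  qed simp
  ultimately show ?case
    by (rule Lim_transform_eventually)
qed

text \<open>With the outer index fixed at \<open>n + 1\<close>, the sum over the tail is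
  \<open>H_minus n w\<close>. The unordered sum is computed over the reals, where nonnegative terms
  give summability, and then embedded in the complex numbers.\<close>

lemma Li_minus_Cons:
  assumes x: "0 < x" "x < 1" and r: "\<And>n. of_nat (Suc n) ^ i * of_rat (H_minus n w) = poly r (of_nat n)"
  shows "Li_minus (of_real x) (i # w) = of_real (x * poly_gen r x)"
proof -
  define f where "f ns = real (monom_at (i # w) ns) * x ^ hd ns" for ns
  \<comment> \<open>The extra factor \<open>x\<close> reflects that the exponent is
    \<open>hd ns = Suc n\<close>.\<close>
  define g where "g n = x * (poly r (of_nat n) * x ^ n)" for n
  let ?h = "\<lambda>(n, ns). Suc n # ns" and ?B = "bounded_tuples (length w)"
  have summable: "summable (\<lambda>n. poly r (of_nat n) * x ^ n)"
    by (rule summable_poly_power) (use x in simp)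
  have r_nonneg: "poly r (of_nat n) \<ge> 0" for n
    unfolding r[symmetric] H_minus_eq of_rat_sum by (intro mult_nonneg_nonneg sum_nonneg) auto
  have inner: "((\<lambda>ns. (f \<circ> ?h) (n, ns)) has_sum g n) (?B n)" for n
  proof (rule has_sum_finiteI)
    have "real_of_rat (H_minus n w) = (\<Sum>ns\<in>?B n. real (monom_at w ns))"
      by (simp add: H_minus_eq of_rat_sum)
    then show "g n = (\<Sum>ns\<in>?B n. (f \<circ> ?h) (n, ns))"
      unfolding g_def r[symmetric]
      by (simp add: f_def monom_at_Cons sum_distrib_left sum_distrib_right mult_ac del: of_nat_Suc)
  qed simp
  have "g sums (x * poly_gen r x)"
    unfolding g_def by (intro sums_mult summable_sums summable)
  then have outer: "(g has_sum (x * poly_gen r x)) UNIV"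
    by (rule sums_nonneg_imp_has_sum) (use x r_nonneg in \<open>simp add: g_def\<close>)
  have sm: "(f \<circ> ?h) summable_on Sigma UNIV ?B"
    by (rule summable_on_SigmaI[OF inner])
       (use outer x in \<open>auto simp: f_def intro: has_sum_imp_summable\<close>)
  have "infsum (f \<circ> ?h) (Sigma UNIV ?B) = (\<Sum>\<^sub>\<infinity>n. \<Sum>\<^sub>\<infinity>ns\<in>?B n. (f \<circ> ?h) (n, ns))"
    by (rule infsum_Sigma_banach[symmetric]) (rule sm)
  also have "\<dots> = x * poly_gen r x"
    unfolding infsumI[OF inner] using outer by (rule infsumI)
  finally have "((f \<circ> ?h) has_sum (x * poly_gen r x)) (Sigma UNIV ?B)"
    using has_sum_infsum[OF sm] by simp
  then have "(f has_sum (x * poly_gen r x)) (dec_tuples (Suc (length w)))"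
    unfolding dec_tuples_Suc by (subst has_sum_reindex) (auto simp: inj_on_def)
  from has_sum_of_real[OF this, where 'a = complex] show ?thesis
    unfolding Li_minus_def f_def by (auto intro!: infsumI)
qed

lemma H_minus_asymptotics:
  "((\<lambda>N::nat. real_of_rat (hadamard (hadamard_inv (g_series (of_nat N))) (H_minus N) w))
    \<longlongrightarrow> of_rat (C_minus w)) sequentially"
proof -
  let ?d = "weight w + length w"
  obtain q :: "real poly" where q: "degree q \<le> ?d" "coeff q ?d = of_rat (C_minus w)"
    "\<And>N. of_rat (H_minus N w) = poly q (of_nat N)"
    using H_minus_polynomial by blast
  show ?thesis
    using poly_over_power_tendsto[OF q(1)]
    by (simp add: hadamard_def hadamard_inv_def g_series_def of_rat_mult of_rat_inverse of_rat_power
        q(2) q(3) divide_inverse mult.commute)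
qed

lemma Li_minus_asymptotics:
  "((\<lambda>x::real. hadamard (hadamard_inv (h_series (inverse (1 - complex_of_real x))))
      (Li_minus (complex_of_real x)) w) \<longlongrightarrow> of_rat (C_minus w)) (at_left 1)"
proof (cases w)
  case Nil
  then show ?thesis
    by (simp add: hadamard_def hadamard_inv_def h_series_def Li_minus_def C_minus_Nil)
next
  case w: (Cons i v)
  let ?k = "i + (weight v + length v)"
  obtain q :: "real poly" where
    q: "degree q \<le> weight v + length v" "coeff q (weight v + length v) = of_rat (C_minus v)"
    "\<And>N. of_rat (H_minus N v) = poly q (of_nat N)"
    using H_minus_polynomial by blast
  define r where "r = [:1, 1:] ^ i * q"
  have r: "degree r \<le> ?k" "coeff r ?k = of_rat (C_minus v)"
    using coeff_linear_power_mult[OF q(1), of 1 i] q(2) by (simp_all add: r_def)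
  have rn: "of_nat (Suc n) ^ i * of_rat (H_minus n v) = poly r (of_nat n)" for n
    by (simp add: r_def q(3) add.commute)
  \<comment> \<open>Weight plus length of \<open>w\<close> is \<open>Suc ?k\<close>, the exponent at
    which the limit of \<open>poly_gen r\<close> is known; \<open>fact ?k / fact (Suc ?k)\<close> is
    the factor that \<open>C_minus\<close> gains with the first letter.\<close>
  let ?F = "\<lambda>x. x * ((1 - x) ^ Suc ?k * poly_gen r x) / fact (Suc ?k)"
  have "(?F \<longlongrightarrow> 1 * (fact ?k * coeff r ?k) / fact (Suc ?k)) (at_left 1)"
    by (intro tendsto_intros poly_power_series_tendsto r(1)) simp
  also have "1 * (fact ?k * coeff r ?k) / fact (Suc ?k) = real_of_rat (C_minus w)"
    unfolding w C_minus_Cons r(2) by (simp add: of_rat_divide of_rat_add add_ac)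
  finally have "((\<lambda>x. complex_of_real (?F x)) \<longlongrightarrow> complex_of_real (real_of_rat (C_minus w))) (at_left 1)"
    by (rule tendsto_of_real)
  moreover have "eventually (\<lambda>x. complex_of_real (?F x)
      = hadamard (hadamard_inv (h_series (inverse (1 - complex_of_real x))))
          (Li_minus (complex_of_real x)) w) (at_left 1)"
  proof (rule eventually_at_leftI[of 0])
    fix x :: real assume "x \<in> {0<..<1}"
    then have Li: "Li_minus (of_real x) w = of_real (x * poly_gen r x)"
      unfolding w by (intro Li_minus_Cons rn) auto
    have d: "weight w + length w = Suc ?k" by (simp add: w)
    show "complex_of_real (?F x) = hadamard (hadamard_inv (h_series (inverse (1 - complex_of_real x))))
          (Li_minus (complex_of_real x)) w"
      unfolding hadamard_def hadamard_inv_def h_series_def Li d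
      by (simp add: power_inverse field_simps del: fact_Suc power_Suc)
  qed simp
  moreover have "complex_of_real (real_of_rat c) = of_rat c" for c
    by (cases c) (simp add: of_rat_rat)
  ultimately show ?thesis
    by (simp add: Lim_transform_eventually)
qed

theorem theorem9:
  shows "(\<forall>N. group_like (H_minus N) \<and> primitive (log_series (H_minus N)))
    \<and> (\<forall>w. ((\<lambda>N::nat. real_of_rat (hadamard (hadamard_inv (g_series (of_nat N))) (H_minus N) w))
               \<longlongrightarrow> of_rat (C_minus w)) sequentially)
    \<and> (\<forall>w. ((\<lambda>x::real. hadamard (hadamard_inv (h_series (inverse (1 - complex_of_real x))))
                          (Li_minus (complex_of_real x)) w)
               \<longlongrightarrow> of_rat (C_minus w)) (at_left 1))
    \<and> primeideal ker_H qsh_ring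
    \<and> (\<forall>P Q. P \<notin> ker_H \<longrightarrow> Q \<notin> ker_H \<longrightarrow> qsh P Q \<notin> ker_H)"
  using group_like_H_minus primitive_log_H_minus H_minus_asymptotics Li_minus_asymptotics
    primeideal_ker_H qsh_in_ker_H_iff by blast

end
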